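(* Let $E$ be a (real) Banach lattice, let $m$ be a positive integer, and let $P\colon E\to\mathbb{R}$ be an orthogonally additive $m$-homogeneous polynomial which is order continuous at some point of $E$. Then $P$ is order continuous at every point of $E$.
   Context: An $m$-homogeneous polynomial $P\colon E\to\mathbb{R}$ is a map of the form $P(x)=A(x,\dots,x)$, where $A\colon E^m\to\mathbb{R}$ is a (unique) symmetric $m$-linear map. $P$ is positive if $A(x_1,\dots,x_m)\ge 0$ for all $x_1,\dots,x_m\in E_+$, and regular if it is a difference of two positive $m$-homogeneous polynomials. A regular $m$-homogeneous polynomial $P$ is orthogonally additive if $P(x+y)=P(x)+P(y)$ whenever $x,y\in E$ are disjoint, i.e. $|x|\wedge|y|=0$ (so orthogonally additive polynomials are regular by definition). A net $(x_\alpha)$ in $E$ converges in order to $x$ if there are a net $(y_\alpha)$ in $E$ decreasing to $0$ (i.e. decreasing with infimum $0$) with the same index set and an index $\alpha_0$ such that $|x_\alpha-x|\le y_\alpha$ for all $\alpha\ge\alpha_0$. $P$ is order continuous at $x$ if $P(x_\alpha)\to P(x)$ whenever $(x_\alpha)$ converges in order to $x$. *)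

theory Defs
  imports
    "HOL-Analysis.Analysis"
    "HOL-Library.Lattice_Algebras"
    "HOL-Library.Lub_Glb"
begin

class banach_lattice = banach + ordered_real_vector + lattice_ab_group_add_abs +
  assumes norm_mono_abs: "\<bar>x\<bar> \<le> \<bar>y\<bar> \<Longrightarrow> norm x \<le> norm y"

instance real :: banach_lattice
  by standard simp

definition disjoint_elems :: "'a::banach_lattice \<Rightarrow> 'a \<Rightarrow> bool"
  where "disjoint_elems x y \<longleftrightarrow> inf \<bar>x\<bar> \<bar>y\<bar> = 0"

text \<open>
  An element \<open>(x\<^sub>1, \<dots>, x\<^sub>m)\<close> of the \<open>m\<close>-fold product of the space is represented by a sequence
  \<open>x :: nat \<Rightarrow> 'a\<close> of which only the values at indices \<open>i < m\<close> count; the first conjunct below says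
  that the remaining values are ignored.
\<close>

definition multilinear :: "nat \<Rightarrow> ((nat \<Rightarrow> 'a::real_vector) \<Rightarrow> 'b::real_vector) \<Rightarrow> bool"
  where "multilinear m A \<longleftrightarrow>
    (\<forall>x y. (\<forall>i<m. x i = y i) \<longrightarrow> A x = A y) \<and>
    (\<forall>x. \<forall>i<m. linear (\<lambda>t. A (x(i := t))))"

definition symmetric_map :: "nat \<Rightarrow> ((nat \<Rightarrow> 'a) \<Rightarrow> 'b) \<Rightarrow> bool"
  where "symmetric_map m A \<longleftrightarrow> (\<forall>x p. p permutes {..<m} \<longrightarrow> A (x \<circ> p) = A x)"

text \<open>
  \<open>A\<close> is the symmetric \<open>m\<close>-linear map generating \<open>P\<close>. By polarization it is determined by \<open>P\<close>, so it
  does not matter that it is existentially quantified separately in each definition using it.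
\<close>

definition generates_poly ::
    "nat \<Rightarrow> ((nat \<Rightarrow> 'a::real_vector) \<Rightarrow> real) \<Rightarrow> ('a \<Rightarrow> real) \<Rightarrow> bool"
  where "generates_poly m A P \<longleftrightarrow>
    multilinear m A \<and> symmetric_map m A \<and> (\<forall>x. P x = A (\<lambda>_. x))"

definition homogeneous_poly :: "nat \<Rightarrow> ('a::real_vector \<Rightarrow> real) \<Rightarrow> bool"
  where "homogeneous_poly m P \<longleftrightarrow> (\<exists>A. generates_poly m A P)"

definition positive_poly :: "nat \<Rightarrow> ('a::banach_lattice \<Rightarrow> real) \<Rightarrow> bool"
  where "positive_poly m P \<longleftrightarrow>
    (\<exists>A. generates_poly m A P \<and> (\<forall>x. (\<forall>i<m. 0 \<le> x i) \<longrightarrow> 0 \<le> A x))"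

definition regular_poly :: "nat \<Rightarrow> ('a::banach_lattice \<Rightarrow> real) \<Rightarrow> bool"
  where "regular_poly m P \<longleftrightarrow> homogeneous_poly m P \<and>
    (\<exists>Q R. positive_poly m Q \<and> positive_poly m R \<and> (\<forall>x. P x = Q x - R x))"

definition orthogonally_additive_poly :: "nat \<Rightarrow> ('a::banach_lattice \<Rightarrow> real) \<Rightarrow> bool"
  where "orthogonally_additive_poly m P \<longleftrightarrow> regular_poly m P \<and>
    (\<forall>x y. disjoint_elems x y \<longrightarrow> P (x + y) = P x + P y)"

text \<open>
  A net is a function on an index set \<open>I\<close> directed by \<open>r\<close>, where \<open>(i, j) \<in> r\<close> means \<open>j \<ge> i\<close>.
\<close>

definition directed_set :: "'i set \<Rightarrow> 'i rel \<Rightarrow> bool"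
  where "directed_set I r \<longleftrightarrow> I \<noteq> {} \<and> preorder_on I r \<and>
    (\<forall>i\<in>I. \<forall>j\<in>I. \<exists>k\<in>I. (i, k) \<in> r \<and> (j, k) \<in> r)"

definition net_filter :: "'i set \<Rightarrow> 'i rel \<Rightarrow> 'i filter"
  where "net_filter I r = (INF i\<in>I. principal {j \<in> I. (i, j) \<in> r})"

lemma eventually_net_filter:
  assumes "directed_set I r"
  shows "eventually Q (net_filter I r) \<longleftrightarrow> (\<exists>i\<in>I. \<forall>j\<in>I. (i, j) \<in> r \<longrightarrow> Q j)"
proof -
  have tr: "trans r" and ne: "I \<noteq> {}"
    and dir: "\<And>i j. i \<in> I \<Longrightarrow> j \<in> I \<Longrightarrow> \<exists>k\<in>I. (i, k) \<in> r \<and> (j, k) \<in> r"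
    using assms by (auto simp: directed_set_def preorder_on_def)
  have "eventually Q (net_filter I r) \<longleftrightarrow>
      (\<exists>i\<in>I. eventually Q (principal {j \<in> I. (i, j) \<in> r}))"
    unfolding net_filter_def
  proof (rule eventually_INF_base[OF ne])
    fix a b assume "a \<in> I" "b \<in> I"
    then obtain k where "k \<in> I" "(a, k) \<in> r" "(b, k) \<in> r"
      using dir by blast
    then show "\<exists>x\<in>I. principal {j \<in> I. (x, j) \<in> r} \<le>
        inf (principal {j \<in> I. (a, j) \<in> r}) (principal {j \<in> I. (b, j) \<in> r})"
      using tr by (intro bexI[of _ k]) (auto dest: transD)
  qed
  then show ?thesis
    by (auto simp: eventually_principal)
qed

definition decreases_to_0 :: "'i set \<Rightarrow> 'i rel \<Rightarrow> ('i \<Rightarrow> 'a::banach_lattice) \<Rightarrow> bool"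
  where "decreases_to_0 I r y \<longleftrightarrow>
    (\<forall>i\<in>I. \<forall>j\<in>I. (i, j) \<in> r \<longrightarrow> y j \<le> y i) \<and> isGlb UNIV (y ` I) 0"

definition order_converges ::
    "'i set \<Rightarrow> 'i rel \<Rightarrow> ('i \<Rightarrow> 'a::banach_lattice) \<Rightarrow> 'a \<Rightarrow> bool"
  where "order_converges I r x a \<longleftrightarrow>
    (\<exists>y. decreases_to_0 I r y \<and> (\<exists>i\<^sub>0\<in>I. \<forall>i\<in>I. (i\<^sub>0, i) \<in> r \<longrightarrow> \<bar>x i - a\<bar> \<le> y i))"

text \<open>
  A definition in HOL cannot quantify over the type of the indices. The index sets here are arbitrary
  subsets of \<open>'a \<times> 'a\<close> with arbitrary directed preorders; the next lemma shows that this already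
  covers nets with indices of any type.
\<close>

definition order_continuous_at :: "('a::banach_lattice \<Rightarrow> real) \<Rightarrow> 'a \<Rightarrow> bool"
  where "order_continuous_at P a \<longleftrightarrow>
    (\<forall>(I :: ('a \<times> 'a) set) r x. directed_set I r \<longrightarrow> order_converges I r x a \<longrightarrow>
       ((\<lambda>i. P (x i)) \<longlongrightarrow> P a) (net_filter I r))"

lemma order_continuous_at_any_net:
  fixes P :: "'a::banach_lattice \<Rightarrow> real" and I :: "'i set"
  assumes cont: "order_continuous_at P a"
    and dir: "directed_set I r"
    and conv: "order_converges I r x a"
  shows "((\<lambda>i. P (x i)) \<longlongrightarrow> P a) (net_filter I r)"
proof (rule ccontr)
  assume "\<not> ?thesis"
  then obtain e where e: "e > 0"
    and "\<not> eventually (\<lambda>i. dist (P (x i)) (P a) < e) (net_filter I r)"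
    unfolding tendsto_iff by blast
  then have bad: "\<And>i. i \<in> I \<Longrightarrow> \<exists>j\<in>I. (i, j) \<in> r \<and> \<not> dist (P (x j)) (P a) < e"
    unfolding eventually_net_filter[OF dir] by blast
  have tr: "trans r"
    and dir2: "\<And>i j. i \<in> I \<Longrightarrow> j \<in> I \<Longrightarrow> \<exists>k\<in>I. (i, k) \<in> r \<and> (j, k) \<in> r"
    using dir by (auto simp: directed_set_def preorder_on_def)
  obtain y i0 where dec: "\<And>i j. i \<in> I \<Longrightarrow> j \<in> I \<Longrightarrow> (i, j) \<in> r \<Longrightarrow> y j \<le> y i"
    and glb: "isGlb UNIV (y ` I) 0" and i0: "i0 \<in> I"
    and le: "\<And>i. i \<in> I \<Longrightarrow> (i0, i) \<in> r \<Longrightarrow> \<bar>x i - a\<bar> \<le> y i"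
    using conv unfolding order_converges_def decreases_to_0_def by blast
  define J where
    "J = {(x i, y i) |i. i \<in> I \<and> (i0, i) \<in> r \<and> \<not> dist (P (x i)) (P a) < e}"
  define s where "s = {(p, q). p \<in> J \<and> q \<in> J \<and> snd q \<le> snd p}"
  have below: "\<exists>q\<in>J. snd q \<le> y i \<and> snd q \<le> y j" if ij: "i \<in> I" "j \<in> I" for i j
  proof -
    obtain k where k: "k \<in> I" "(i, k) \<in> r" "(j, k) \<in> r"
      using dir2 ij by blast
    obtain l where l: "l \<in> I" "(k, l) \<in> r" "(i0, l) \<in> r"
      using dir2 k(1) i0 by blast
    obtain n where n: "n \<in> I" "(l, n) \<in> r" "\<not> dist (P (x n)) (P a) < e"
      using bad l(1) by blast
    have "(i, n) \<in> r" "(j, n) \<in> r" "(i0, n) \<in> r"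
      using tr k l n by (meson transD)+
    then have "(x n, y n) \<in> J" "y n \<le> y i" "y n \<le> y j"
      using n ij dec by (auto simp: J_def)
    then show ?thesis
      by (intro bexI[of _ "(x n, y n)"]) auto
  qed
  have snd_J: "\<exists>i\<in>I. snd p = y i" if "p \<in> J" for p
    using that by (auto simp: J_def)
  have dJ: "directed_set J s"
    unfolding directed_set_def
  proof (intro conjI ballI)
    show "J \<noteq> {}"
      using below[OF i0 i0] by blast
    show "preorder_on J s"
      by (auto simp: preorder_on_def refl_on_def trans_def s_def)
    fix p q assume pq: "p \<in> J" "q \<in> J"
    then obtain i j where "i \<in> I" "j \<in> I" "snd p = y i" "snd q = y j"
      using snd_J by metis
    with below[of i j] pq show "\<exists>k\<in>J. (p, k) \<in> s \<and> (q, k) \<in> s"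
      by (auto simp: s_def)
  qed
  have "isGlb UNIV (snd ` J) 0"
  proof -
    have "0 \<le> snd p" if "p \<in> J" for p
      using snd_J[OF that] glb by (auto dest: isGlbD2)
    moreover have "z \<le> 0" if z: "\<And>p. p \<in> J \<Longrightarrow> z \<le> snd p" for z
    proof -
      have "z \<le> y i" if "i \<in> I" for i
        using below[OF that that] z order_trans by blast
      then have "isLb UNIV (y ` I) z"
        by (auto simp: isLb_def setge_def)
      then show ?thesis
        using glb isGlb_le_isLb by blast
    qed
    ultimately show ?thesis
      by (auto simp: isGlb_def greatestP_def isLb_def setge_def setle_def)
  qed
  then have "decreases_to_0 J s snd"
    by (auto simp: decreases_to_0_def s_def)
  moreover have "\<forall>p\<in>J. \<bar>fst p - a\<bar> \<le> snd p"
    using le by (auto simp: J_def)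
  ultimately have "order_converges J s fst a"
    using dJ unfolding order_converges_def directed_set_def by blast
  with cont dJ have "((\<lambda>p. P (fst p)) \<longlongrightarrow> P a) (net_filter J s)"
    unfolding order_continuous_at_def by blast
  then have "eventually (\<lambda>p. dist (P (fst p)) (P a) < e) (net_filter J s)"
    using e by (rule tendstoD)
  then obtain p where "p \<in> J" "\<forall>q\<in>J. (p, q) \<in> s \<longrightarrow> dist (P (fst q)) (P a) < e"
    unfolding eventually_net_filter[OF dJ] by blast
  then have "dist (P (fst p)) (P a) < e"
    by (auto simp: s_def)
  with \<open>p \<in> J\<close> show False
    by (auto simp: J_def)
qed

end

theory Submission
  imports Defs "HOL-Combinatorics.Permutations"
begin

text \<open>
  Write \<open>P x = A(x, \<dots>, x)\<close>, with \<open>A\<close> dominated by a positive form \<open>T\<close>.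

  The alternating sum of the values \<open>P (a + \<Sum>\<^bsub>i\<in>S\<^esub> z\<^sub>i)\<close> over the sets \<open>S\<close> of indices is a multiple of
  \<open>A z\<close> whatever the base point \<open>a\<close>. Hence order continuity at \<open>a\<close> implies order continuity at \<open>0\<close>.

  Orthogonal additivity makes \<open>A\<close> vanish as soon as two of its arguments are disjoint, and therefore
  \<open>P (u + v + w) - P (u + v) = P (v + w) - P v\<close> for disjoint \<open>u\<close> and \<open>w\<close>.

  To pass from \<open>0\<close> to \<open>b\<close>, let \<open>z\<close> be small in order and \<open>\<epsilon> > 0\<close>. Truncation of \<open>z\<close> at \<open>\<epsilon>\<bar>b\<bar>\<close> and of
  \<open>b\<close> at \<open>\<bar>z\<bar>/\<epsilon>\<close> gives \<open>s\<close> and \<open>t\<close> such that \<open>\<bar>z - s\<bar> \<le> \<epsilon>\<bar>b\<bar>\<close>, \<open>\<bar>t\<bar> \<le> \<bar>z\<bar>/\<epsilon>\<close> and \<open>b - t\<close> is disjoint from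
  \<open>s\<close>. Then \<open>P (b + z) - P (b + s)\<close> is of order \<open>\<epsilon>\<close>, and \<open>P (b + s) - P b = P (t + s) - P t\<close> tends to
  \<open>0\<close> because \<open>s\<close> and \<open>t\<close> converge to \<open>0\<close> in order.
\<close>

section \<open>Disjointness in Banach lattices\<close>

lemma disjoint_elems_iff: "disjoint_elems x y \<longleftrightarrow> inf \<bar>x\<bar> \<bar>y\<bar> \<le> 0"
  unfolding disjoint_elems_def by (auto intro: antisym)

lemma disjoint_elems_commute: "disjoint_elems x y \<longleftrightarrow> disjoint_elems y x"
  by (simp add: disjoint_elems_def inf_commute)

lemma disjoint_elems_mono:
  assumes "disjoint_elems x y" "\<bar>x'\<bar> \<le> \<bar>x\<bar>" "\<bar>y'\<bar> \<le> \<bar>y\<bar>"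
  shows "disjoint_elems x' y'"
  using assms unfolding disjoint_elems_iff by (meson inf_mono order_trans)

lemma disjoint_elems_zero: "disjoint_elems 0 y"
  by (simp add: disjoint_elems_iff)

lemma disjoint_elems_add:
  fixes x y w :: "'a::banach_lattice"
  assumes "disjoint_elems x w" "disjoint_elems y w"
  shows "disjoint_elems (x + y) w"
proof -
  define z where "z = inf \<bar>x + y\<bar> \<bar>w\<bar>"
  have "z \<le> \<bar>x + y\<bar>" and zw: "z \<le> \<bar>w\<bar>"
    by (simp_all add: z_def)
  then have zs: "z \<le> \<bar>x\<bar> + \<bar>y\<bar>"
    using abs_triangle_ineq order_trans by blast
  \<comment> \<open>The right side unfolds to the infimum of four sums. One is
    \<open>|x| + |y|\<close>; each of the others contains \<open>|w|\<close> and a nonnegative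
    summand, so all four dominate \<open>z\<close>.\<close>
  have "z \<le> inf \<bar>x\<bar> \<bar>w\<bar> + inf \<bar>y\<bar> \<bar>w\<bar>"
    unfolding add_inf_distrib_left add_inf_distrib_right
    using zs zw by (auto intro: add_increasing add_increasing2)
  then show ?thesis
    using assms by (simp add: disjoint_elems_def flip: z_def) (simp add: z_def antisym)
qed

lemma disjoint_elems_sum:
  assumes "finite K" "\<And>i. i \<in> K \<Longrightarrow> disjoint_elems (f i) w"
  shows "disjoint_elems (\<Sum>i\<in>K. f i) w"
  using assms
  by (induction K rule: finite_induct) (auto intro: disjoint_elems_add disjoint_elems_zero)

lemma abs_le_sum_abs:
  fixes f :: "'b \<Rightarrow> 'a::ordered_ab_group_add_abs"
  assumes "finite K" "j \<in> K"
  shows "\<bar>f j\<bar> \<le> (\<Sum>i\<in>K. \<bar>f i\<bar>)"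
  using sum_nonneg[of "K - {j}" "\<lambda>i. \<bar>f i\<bar>"] sum.remove[OF assms, of "\<lambda>i. \<bar>f i\<bar>"]
  by simp

lemma abs_scaleR_le:
  fixes x :: "'a::banach_lattice"
  shows "\<bar>c *\<^sub>R x\<bar> \<le> \<bar>c\<bar> *\<^sub>R \<bar>x\<bar>"
proof (cases "c \<ge> 0")
  case True
  then show ?thesis
    by (intro abs_leI)
      (auto simp flip: scaleR_minus_right intro!: scaleR_left_mono abs_ge_self abs_ge_minus_self)
next
  case False
  then have "c *\<^sub>R x = (-c) *\<^sub>R (- x)" "- (c *\<^sub>R x) = (-c) *\<^sub>R x"
    by simp_all
  with False show ?thesis
    by (intro abs_leI)
      (auto simp del: scaleR_minus_left scaleR_minus_right
        intro!: scaleR_left_mono abs_ge_self abs_ge_minus_self)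
qed

lemma disjoint_elems_scaleR:
  fixes x y :: "'a::banach_lattice"
  assumes "disjoint_elems x y"
  shows "disjoint_elems (c *\<^sub>R x) y"
proof -
  \<comment> \<open>\<open>N\<close> is at least both \<open>|c|\<close> and 1, so that
    \<open>z / N\<close> lies below \<open>|x|\<close> and below \<open>|y|\<close> at once.\<close>
  define N where "N = max 1 \<bar>c\<bar>"
  have N: "N \<ge> 1" "N > 0" "\<bar>c\<bar> \<le> N" by (auto simp: N_def)
  define z where "z = inf \<bar>c *\<^sub>R x\<bar> \<bar>y\<bar>"
  have "z \<le> \<bar>c *\<^sub>R x\<bar>" by (simp add: z_def)
  also have "\<dots> \<le> \<bar>c\<bar> *\<^sub>R \<bar>x\<bar>" by (rule abs_scaleR_le)
  also have "\<dots> \<le> N *\<^sub>R \<bar>x\<bar>" using N by (intro scaleR_right_mono) auto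
  finally have "inverse N *\<^sub>R z \<le> \<bar>x\<bar>"
    using N by (simp add: pos_divideR_le_eq)
  moreover have "z \<le> \<bar>y\<bar>" by (simp add: z_def)
  then have "z \<le> N *\<^sub>R \<bar>y\<bar>"
    using scaleR_right_mono[OF N(1), of "\<bar>y\<bar>"] by (auto intro: order_trans)
  then have "inverse N *\<^sub>R z \<le> \<bar>y\<bar>"
    using N by (simp add: pos_divideR_le_eq)
  ultimately have "inverse N *\<^sub>R z \<le> inf \<bar>x\<bar> \<bar>y\<bar>" by simp
  then have "inverse N *\<^sub>R z \<le> 0"
    using assms unfolding disjoint_elems_iff by (rule order_trans)
  then have "z \<le> 0"
    using N by (simp add: pos_divideR_le_eq)
  then show ?thesis by (simp add: disjoint_elems_iff z_def)
qed

section \<open>Truncation and disjoint parts\<close>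

lemma inf_pprt_pprt_minus:
  fixes a :: "'a::lattice_ab_group_add"
  shows "inf (pprt a) (pprt (- a)) = 0"
proof -
  have "inf (pprt a) (pprt (- a)) = inf (a - nprt a) (0 - nprt a)"
    using prts[of a] by (metis add_diff_cancel_right' diff_0 pprt_neg)
  also have "\<dots> = inf a 0 - nprt a"
    using add_inf_distrib_right[of a 0 "- nprt a"] by simp
  finally show ?thesis by (simp add: nprt_def)
qed

text \<open>The positive and negative parts of \<open>x\<close> are truncated at \<open>c\<close>
  separately: \<open>y\<close> is the difference of the truncations, \<open>z\<close> that of the
  excesses. A difference of two elements of an interval \<open>[0, w]\<close> has modulus at most
  \<open>w\<close>.\<close>

lemma clip:
  fixes x c :: "'a::lattice_ab_group_add_abs"
  assumes "c \<ge> 0"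
  obtains y z where "x = y + z" "\<bar>y\<bar> \<le> c" "\<bar>z\<bar> \<le> pprt (\<bar>x\<bar> - c)"
proof
  let ?p = "pprt x" and ?q = "- nprt x"
  have absx: "\<bar>x\<bar> = ?p + ?q" by (simp add: abs_prts)
  have pos: "0 \<le> ?p" "0 \<le> ?q" by simp_all
  have split: "u = inf u c + pprt (u - c)" for u :: 'a
  proof -
    have "pprt (u - c) = u - inf u c"
      by (simp add: pprt_def diff_inf_eq_sup sup_commute add_sup_distrib_left)
    then show ?thesis by (simp del: diff_inf_eq_sup)
  qed
  show "x = (inf ?p c - inf ?q c) + (pprt (?p - c) - pprt (?q - c))"
    using split[of ?p] split[of ?q] prts[of x] by (metis add_diff_add diff_minus_eq_add)
  have interval: "\<bar>u - v\<bar> \<le> w" if "0 \<le> u" "u \<le> w" "0 \<le> v" "v \<le> w" for u v w :: 'a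
  proof (rule abs_leI)
    show "u - v \<le> w" using that by (metis diff_mono diff_zero)
    show "- (u - v) \<le> w" using that by (metis diff_mono diff_zero minus_diff_eq)
  qed
  show "\<bar>inf ?p c - inf ?q c\<bar> \<le> c"
    using assms pos by (intro interval) auto
  show "\<bar>pprt (?p - c) - pprt (?q - c)\<bar> \<le> pprt (\<bar>x\<bar> - c)"
    using pos by (intro interval) (auto simp: absx intro!: pprt_mono)
qed

lemma pprt_abs_diff_le:
  fixes x c :: "'a::lattice_ab_group_add_abs"
  assumes "c \<ge> 0"
  shows "pprt (\<bar>x\<bar> - c) \<le> \<bar>x\<bar>"
  using assms by (simp add: pprt_def)

text \<open>Since \<open>b - a/e\<close> is a negative multiple of \<open>a - e b\<close>, the two
  bounds are, up to a positive factor, the positive and the negative part of one element.\<close>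

lemma disjoint_elems_clipped:
  fixes s t a b :: "'a::banach_lattice"
  assumes e: "e > 0"
    and s: "\<bar>s\<bar> \<le> pprt (a - e *\<^sub>R b)" and t: "\<bar>t\<bar> \<le> pprt (b - (1/e) *\<^sub>R a)"
  shows "disjoint_elems s t"
proof -
  let ?u = "b - (1/e) *\<^sub>R a"
  have eu: "e *\<^sub>R ?u = - (a - e *\<^sub>R b)"
    using e by (simp add: algebra_simps)
  have "?u = (1/e) *\<^sub>R (e *\<^sub>R ?u)" using e by simp
  also have "\<dots> \<le> (1/e) *\<^sub>R pprt (e *\<^sub>R ?u)"
    using e by (intro scaleR_left_mono) (auto simp: pprt_def)
  finally have "pprt ?u \<le> (1/e) *\<^sub>R pprt (e *\<^sub>R ?u)"
    unfolding pprt_def[of ?u] using e by (auto intro!: scaleR_nonneg_nonneg)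
  then have t': "\<bar>t\<bar> \<le> (1/e) *\<^sub>R pprt (- (a - e *\<^sub>R b))"
    using t unfolding eu by (rule order_trans[rotated])
  have "disjoint_elems (pprt (- (a - e *\<^sub>R b))) (pprt (a - e *\<^sub>R b))"
    using inf_pprt_pprt_minus[of "a - e *\<^sub>R b"]
    by (simp add: disjoint_elems_def inf_commute)
  then have "disjoint_elems ((1/e) *\<^sub>R pprt (- (a - e *\<^sub>R b))) (pprt (a - e *\<^sub>R b))"
    by (rule disjoint_elems_scaleR)
  then have "disjoint_elems t s"
    by (rule disjoint_elems_mono)
      (use s t' abs_ge_self order_trans in blast)+
  then show ?thesis by (simp add: disjoint_elems_commute)
qed


text \<open>\<open>s\<close> is the excess of \<open>x\<close> over \<open>e|b|\<close>, and
  \<open>t\<close> is \<open>b\<close> truncated at \<open>|x|/e\<close>. The two levels are matched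
  so that \<open>disjoint_elems_clipped\<close> applies to \<open>s\<close> and the excess
  \<open>b - t\<close>.\<close>

lemma disjoint_splitting:
  fixes x b :: "'a::banach_lattice"
  assumes e: "e > 0"
  obtains s t where "\<bar>x - s\<bar> \<le> e *\<^sub>R \<bar>b\<bar>" "\<bar>s\<bar> \<le> \<bar>x\<bar>" "\<bar>t\<bar> \<le> (1/e) *\<^sub>R \<bar>x\<bar>"
    "disjoint_elems (b - t) s"
proof -
  have b: "0 \<le> e *\<^sub>R \<bar>b\<bar>" and x: "0 \<le> (1/e) *\<^sub>R \<bar>x\<bar>"
    using e by (auto intro: scaleR_nonneg_nonneg)
  obtain s' s where s: "x = s' + s" "\<bar>s'\<bar> \<le> e *\<^sub>R \<bar>b\<bar>" "\<bar>s\<bar> \<le> pprt (\<bar>x\<bar> - e *\<^sub>R \<bar>b\<bar>)"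
    using clip[OF b, of x] by blast
  obtain t t' where t: "b = t + t'" "\<bar>t\<bar> \<le> (1/e) *\<^sub>R \<bar>x\<bar>" "\<bar>t'\<bar> \<le> pprt (\<bar>b\<bar> - (1/e) *\<^sub>R \<bar>x\<bar>)"
    using clip[OF x, of b] by blast
  show thesis
  proof
    show "\<bar>x - s\<bar> \<le> e *\<^sub>R \<bar>b\<bar>" "\<bar>t\<bar> \<le> (1/e) *\<^sub>R \<bar>x\<bar>"
      using s t by simp_all
    show "\<bar>s\<bar> \<le> \<bar>x\<bar>"
      using s(3) pprt_abs_diff_le[OF b] by (rule order_trans)
    show "disjoint_elems (b - t) s"
      using disjoint_elems_clipped[OF e s(3) t(3)] t(1) by (simp add: disjoint_elems_commute)
  qed
qed

section \<open>Multilinear forms\<close>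

lemma multilinear_cong:
  assumes "multilinear m A" "\<And>i. i < m \<Longrightarrow> x i = y i"
  shows "A x = A y"
  using assms by (auto simp: multilinear_def)

lemma multilinear_linear:
  assumes "multilinear m A" "k < m"
  shows "linear (\<lambda>t. A (x(k := t)))"
  using assms by (auto simp: multilinear_def)

lemma multilinear_zero:
  assumes "multilinear m A" "k < m" "x k = 0"
  shows "A x = 0"
  using linear_0[OF multilinear_linear[OF assms(1,2), of x]] assms(3)
  by (metis fun_upd_triv)

text \<open>The arguments are exchanged one at a time from the left; by linearity in the slot being
  exchanged, each difference is a single value of \<open>A\<close>.\<close>

lemma multilinear_telescope:
  assumes "multilinear m A"
  shows "A x' - A x =
    (\<Sum>j<m. A (\<lambda>i. if i < j then x' i else if i = j then x' i - x i else x i))"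
proof -
  define h where "h j = (\<lambda>i. if i < j then x' i else x i)" for j
  have "A (h (Suc j)) - A (h j) =
      A (\<lambda>i. if i < j then x' i else if i = j then x' i - x i else x i)" if "j < m" for j
  proof -
    have "h (Suc j) = (h j)(j := x' j)" "h j = (h j)(j := x j)"
      "(h j)(j := x' j - x j) = (\<lambda>i. if i < j then x' i else if i = j then x' i - x i else x i)"
      by (auto simp: h_def)
    then show ?thesis
      using linear_diff[OF multilinear_linear[OF assms that, of "h j"], of "x' j" "x j"] by metis
  qed
  then have "(\<Sum>j<m. A (\<lambda>i. if i < j then x' i else if i = j then x' i - x i else x i)) =
      (\<Sum>j<m. A (h (Suc j)) - A (h j))"
    by simp
  also have "\<dots> = A (h m) - A (h 0)"
    by (rule sum_lessThan_telescope)
  also have "h 0 = x" by (simp add: h_def)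
  also have "A (h m) = A x'"
    by (rule multilinear_cong[OF assms]) (simp add: h_def)
  finally show ?thesis by simp
qed

lemma multilinear_sum:
  assumes A: "multilinear m A" and K: "finite K"
  shows "A (\<lambda>i. \<Sum>k\<in>K. g i k) = (\<Sum>f\<in>{..<m} \<rightarrow>\<^sub>E K. A (\<lambda>i. g i (f i)))"
proof -
  \<comment> \<open>Only the first \<open>n\<close> slots are expanded. The filler \<open>h\<close>
    stays arbitrary because the induction step puts a summand \<open>g n k\<close> into slot
    \<open>n\<close>.\<close>
  have "A (\<lambda>i. if i < n then \<Sum>k\<in>K. g i k else h i) =
      (\<Sum>f\<in>{..<n} \<rightarrow>\<^sub>E K. A (\<lambda>i. if i < n then g i (f i) else h i))" if "n \<le> m" for n h
    using that
  proof (induction n arbitrary: h)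
    case 0
    then show ?case by simp
  next
    case (Suc n)
    have n: "n < m" using Suc by simp
    let ?h = "\<lambda>i. if i < n then \<Sum>k\<in>K. g i k else h i"
    have "A (\<lambda>i. if i < Suc n then \<Sum>k\<in>K. g i k else h i) = A (?h(n := \<Sum>k\<in>K. g n k))"
      by (rule arg_cong[of _ _ A]) auto
    also have "\<dots> = (\<Sum>k\<in>K. A (?h(n := g n k)))"
      using linear_sum[OF multilinear_linear[OF A n]] by simp
    also have "\<dots> = (\<Sum>k\<in>K. \<Sum>f\<in>{..<n} \<rightarrow>\<^sub>E K.
        A (\<lambda>i. if i < n then g i (f i) else (h(n := g n k)) i))"
    proof (rule sum.cong[OF refl])
      fix k
      have "?h(n := g n k) = (\<lambda>i. if i < n then \<Sum>k\<in>K. g i k else (h(n := g n k)) i)"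
        by auto
      then show "A (?h(n := g n k)) = (\<Sum>f\<in>{..<n} \<rightarrow>\<^sub>E K.
          A (\<lambda>i. if i < n then g i (f i) else (h(n := g n k)) i))"
        using Suc.IH[of "h(n := g n k)"] n by simp
    qed
    also have "\<dots> = (\<Sum>(k, f)\<in>K \<times> ({..<n} \<rightarrow>\<^sub>E K).
        A (\<lambda>i. if i < n then g i (f i) else (h(n := g n k)) i))"
      by (rule sum.cartesian_product)
    also have "\<dots> = (\<Sum>(k, f)\<in>K \<times> ({..<n} \<rightarrow>\<^sub>E K).
        A (\<lambda>i. if i < Suc n then g i ((f(n := k)) i) else h i))"
    proof -
      have "(\<lambda>i. if i < n then g i (f i) else (h(n := g n k)) i) =
          (\<lambda>i. if i < Suc n then g i ((f(n := k)) i) else h i)" for k f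
        by (auto simp: less_Suc_eq)
      then show ?thesis by simp
    qed
    also have "\<dots> = (\<Sum>f\<in>{..<Suc n} \<rightarrow>\<^sub>E K. A (\<lambda>i. if i < Suc n then g i (f i) else h i))"
    proof -
      have "inj_on (\<lambda>(y, g). g(n := y)) (K \<times> ({..<n} \<rightarrow>\<^sub>E K))"
        by (rule inj_combinator) simp
      then show ?thesis
        unfolding lessThan_Suc PiE_insert_eq
        by (simp add: sum.reindex case_prod_unfold)
    qed
    finally show ?case .
  qed
  from this[of m "\<lambda>_. 0"] have "A (\<lambda>i. if i < m then \<Sum>k\<in>K. g i k else 0) =
      (\<Sum>f\<in>{..<m} \<rightarrow>\<^sub>E K. A (\<lambda>i. if i < m then g i (f i) else 0))" by simp
  moreover have "A (\<lambda>i. if i < m then \<Sum>k\<in>K. g i k else 0) = A (\<lambda>i. \<Sum>k\<in>K. g i k)"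
    by (rule multilinear_cong[OF A]) simp
  moreover have "A (\<lambda>i. if i < m then g i (f i) else 0) = A (\<lambda>i. g i (f i))" for f
    by (rule multilinear_cong[OF A]) simp
  ultimately show ?thesis by simp
qed

section \<open>Polarization\<close>

text \<open>This is the expansion of the product over \<open>X\<close> of \<open>c i - 1\<close>,
  where \<open>c\<close> is 0 on \<open>T\<close> and 1 elsewhere. \<open>S\<close> collects the
  factors contributing -1; its term survives exactly when \<open>X - S\<close> misses
  \<open>T\<close>.\<close>

lemma sum_Pow_alternating_superset:
  assumes "finite X"
  shows "(\<Sum>S\<in>Pow X. if T \<inter> X \<subseteq> S then (-1) ^ card S else 0) =
    (if X \<subseteq> T then (-1) ^ card X else (0::real))"
proof -
  let ?c = "\<lambda>i. if i \<in> T then 0 else 1 :: real"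
  have "(\<Prod>i\<in>X - S. ?c i) = (if T \<inter> X \<subseteq> S then 1 else 0)" if "S \<subseteq> X" for S
  proof (cases "T \<inter> X \<subseteq> S")
    case True
    then show ?thesis by (auto intro!: prod.neutral)
  next
    case False
    then show ?thesis using assms that by auto
  qed
  then have "(\<Sum>S\<in>Pow X. if T \<inter> X \<subseteq> S then (-1) ^ card S else 0) =
      (\<Sum>S\<in>Pow X. (-1) ^ card S * (\<Prod>i\<in>S. 1) * (\<Prod>i\<in>X - S. ?c i))"
    by (intro sum.cong) (auto simp del: prod_zero_iff)
  also have "\<dots> = (\<Prod>i\<in>X. ?c i - 1)"
    by (rule prod_diff_conv_sum[symmetric]) (rule assms)
  also have "\<dots> = (if X \<subseteq> T then (-1) ^ card X else 0)"
  proof (cases "X \<subseteq> T")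
    case True
    then have "(\<Prod>i\<in>X. ?c i - 1) = (\<Prod>i\<in>X. -1)"
      by (intro prod.cong) auto
    with True show ?thesis by simp
  next
    case False
    with assms show ?thesis by auto
  qed
  finally show ?thesis .
qed

lemma sum_Pow_alternating:
  assumes "finite X" "X \<noteq> {}"
  shows "(\<Sum>S\<in>Pow X. (-1) ^ card S) = (0::real)"
  using sum_Pow_alternating_superset[of X "{}"] assms by simp

text \<open>With \<open>a\<close> adjoined as vector number \<open>m\<close>, each value of
  \<open>P\<close> expands over maps \<open>f\<close> from the \<open>m\<close> slots to the
  \<open>m + 1\<close> vectors. The alternating sum kills every \<open>f\<close> that misses an
  index below \<open>m\<close>. The others fill all slots with a permutation, so \<open>a\<close>
  drops out and symmetry leaves \<open>m!\<close> copies of \<open>A z\<close>.\<close>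

lemma polarization:
  fixes P :: "'a::real_vector \<Rightarrow> real"
  assumes "generates_poly m A P"
  shows "(\<Sum>S\<in>Pow {..<m}. (-1) ^ card S * P (a + (\<Sum>i\<in>S. z i))) = (-1) ^ m * fact m * A z"
proof -
  have A: "multilinear m A" and sym: "symmetric_map m A" and PA: "\<And>x. P x = A (\<lambda>_. x)"
    using assms by (auto simp: generates_poly_def)
  let ?z = "z(m := a)" and ?F = "{..<m} \<rightarrow>\<^sub>E {..m}"
  let ?w = "\<lambda>f. A (\<lambda>i. ?z (f i))"
  have finF: "finite ?F" by (intro finite_PiE) auto
  have P: "P (a + (\<Sum>i\<in>S. z i)) =
      (\<Sum>f\<in>?F. if f ` {..<m} \<inter> {..<m} \<subseteq> S then ?w f else 0)" if S: "S \<subseteq> {..<m}" for S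
  proof -
    have fin: "finite S" and m: "m \<notin> S" using S finite_subset by auto
    then have "(\<Sum>k\<in>S. ?z k) = (\<Sum>k\<in>S. z k)" by (intro sum.cong) auto
    with fin m have "a + (\<Sum>i\<in>S. z i) = (\<Sum>k\<in>insert m S. ?z k)" by simp
    then have "P (a + (\<Sum>i\<in>S. z i)) = (\<Sum>f\<in>{..<m} \<rightarrow>\<^sub>E insert m S. ?w f)"
      using multilinear_sum[OF A, of "insert m S" "\<lambda>_. ?z"] fin by (simp add: PA)
    also have "{..<m} \<rightarrow>\<^sub>E insert m S = {f \<in> ?F. f ` {..<m} \<inter> {..<m} \<subseteq> S}"
    proof (intro equalityI subsetI)
      fix f assume "f \<in> {..<m} \<rightarrow>\<^sub>E insert m S"
      then have f: "\<And>i. i < m \<Longrightarrow> f i = m \<or> f i \<in> S" "f \<in> extensional {..<m}"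
        by (auto simp: PiE_iff)
      have "f i \<le> m" if "i < m" for i
        using f(1)[OF that] S by auto
      with f show "f \<in> {f \<in> ?F. f ` {..<m} \<inter> {..<m} \<subseteq> S}"
        by (auto simp: PiE_iff)
    next
      fix f assume "f \<in> {f \<in> ?F. f ` {..<m} \<inter> {..<m} \<subseteq> S}"
      then have f: "f \<in> ?F" "f ` {..<m} \<inter> {..<m} \<subseteq> S" by auto
      have "f i \<in> insert m S" if "i < m" for i
        using f that by (cases "f i = m") (force simp: PiE_iff)+
      with f show "f \<in> {..<m} \<rightarrow>\<^sub>E insert m S"
        by (auto simp: PiE_iff)
    qed
    finally show ?thesis
      using finF by (simp add: sum.inter_filter del: fun_upd_apply)
  qed
  have "(\<Sum>S\<in>Pow {..<m}. (-1) ^ card S * P (a + (\<Sum>i\<in>S. z i))) =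
      (\<Sum>S\<in>Pow {..<m}. \<Sum>f\<in>?F.
        (if f ` {..<m} \<inter> {..<m} \<subseteq> S then (-1) ^ card S else 0) * ?w f)"
    by (intro sum.cong refl) (auto simp: P sum_distrib_left simp del: fun_upd_apply intro!: sum.cong)
  also have "\<dots> = (\<Sum>f\<in>?F. (\<Sum>S\<in>Pow {..<m}.
        if f ` {..<m} \<inter> {..<m} \<subseteq> S then (-1) ^ card S else 0) * ?w f)"
    by (subst sum.swap) (simp add: sum_distrib_right del: fun_upd_apply)
  also have "\<dots> = (\<Sum>f\<in>?F. if {..<m} \<subseteq> f ` {..<m} then (-1) ^ m * ?w f else 0)"
    by (intro sum.cong refl) (subst sum_Pow_alternating_superset, auto)
  also have "\<dots> = (\<Sum>f\<in>{f \<in> ?F. {..<m} \<subseteq> f ` {..<m}}. (-1) ^ m * ?w f)"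
    using finF by (simp add: sum.inter_filter del: fun_upd_apply)
  also have "\<dots> = (\<Sum>p\<in>{p. p permutes {..<m}}. (-1) ^ m * A z)"
  \<comment> \<open>Elements of \<open>?F\<close> are \<open>undefined\<close> outside
    \<open>{..<m}\<close>, while permutations are the identity there; the two witnesses translate
    between these conventions.\<close>
  proof (rule sum.reindex_bij_witness[of _ "\<lambda>p. restrict p {..<m}" "\<lambda>f i. if i < m then f i else i"])
    fix f assume "f \<in> {f \<in> ?F. {..<m} \<subseteq> f ` {..<m}}"
    then have f: "f \<in> ?F" and sup: "{..<m} \<subseteq> f ` {..<m}" by auto
    have "card (f ` {..<m}) \<le> card {..<m}" by (rule card_image_le) simp
    then have im: "f ` {..<m} = {..<m}"
      using sup by (intro card_seteq[symmetric]) auto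
    then have inj: "inj_on f {..<m}"
      by (intro eq_card_imp_inj_on) auto
    have "bij_betw f {..<m} {..<m}" using im inj by (simp add: bij_betw_def)
    then have bij: "bij_betw (\<lambda>i. if i < m then f i else i) {..<m} {..<m}"
      by (subst bij_betw_cong[of _ _ f]) auto
    show perm: "(\<lambda>i. if i < m then f i else i) \<in> {p. p permutes {..<m}}"
      using bij_imp_permutes[OF bij] by simp
    show "restrict (\<lambda>i. if i < m then f i else i) {..<m} = f"
      using f by (auto simp: PiE_iff extensional_def restrict_def)
    have "?w f = A (z \<circ> (\<lambda>i. if i < m then f i else i))"
      using im by (intro multilinear_cong[OF A]) (auto simp: fun_eq_iff)
    also have "\<dots> = A z"
      using sym perm unfolding symmetric_map_def by blast
    finally show "(-1) ^ m * A z = (-1) ^ m * ?w f" by simp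
  next
    fix p assume "p \<in> {p. p permutes {..<m}}"
    then have p: "p permutes {..<m}" by simp
    show "(\<lambda>i. if i < m then restrict p {..<m} i else i) = p"
      using p by (auto simp: permutes_def fun_eq_iff)
    have "restrict p {..<m} ` {..<m} = {..<m}"
      using permutes_image[OF p] by simp
    then show "restrict p {..<m} \<in> {f \<in> ?F. {..<m} \<subseteq> f ` {..<m}}"
      using permutes_in_image[OF p] less_imp_le by auto
  qed
  also have "\<dots> = (-1) ^ m * fact m * A z"
    by (simp add: card_permutations)
  finally show ?thesis .
qed

section \<open>Estimates for positive forms\<close>

lemma positive_multilinear_abs_le:
  fixes T :: "(nat \<Rightarrow> 'a::banach_lattice) \<Rightarrow> real"
  assumes T: "multilinear m T" and pos: "\<And>x. (\<And>i. i < m \<Longrightarrow> 0 \<le> x i) \<Longrightarrow> 0 \<le> T x"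
  shows "\<bar>T x\<bar> \<le> T (\<lambda>i. \<bar>x i\<bar>)"
proof -
  \<comment> \<open>Induction on the number of leading arguments of unknown sign. Splitting argument
    \<open>n\<close> into positive and negative part makes it nonnegative in both resulting terms,
    and the two bounds recombine to \<open>|x n|\<close>.\<close>
  have "\<bar>T x\<bar> \<le> T (\<lambda>i. if i < n then \<bar>x i\<bar> else x i)"
    if "n \<le> m" "\<And>i. n \<le> i \<Longrightarrow> i < m \<Longrightarrow> 0 \<le> x i" for n x
    using that
  proof (induction n arbitrary: x)
    case 0
    then show ?case using pos[of x] by simp
  next
    case (Suc n)
    have n: "n < m" using Suc.prems by simp
    let ?g = "\<lambda>i. if i < n then \<bar>x i\<bar> else x i"
    have IH: "\<bar>T (x(n := u))\<bar> \<le> T (?g(n := u))" if "0 \<le> u" for u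
    proof -
      have "0 \<le> (x(n := u)) i" if "n \<le> i" "i < m" for i
        using that \<open>0 \<le> u\<close> Suc.prems(2)[of i] by (cases "i = n") auto
      then have "\<bar>T (x(n := u))\<bar> \<le> T (\<lambda>i. if i < n then \<bar>(x(n := u)) i\<bar> else (x(n := u)) i)"
        using n by (intro Suc.IH) auto
      also have "(\<lambda>i. if i < n then \<bar>(x(n := u)) i\<bar> else (x(n := u)) i) = ?g(n := u)"
        by auto
      finally show ?thesis .
    qed
    have "x n = pprt (x n) - (- nprt (x n))" using prts[of "x n"] by simp
    then have "T x = T (x(n := pprt (x n) - (- nprt (x n))))" by (metis fun_upd_triv)
    also have "\<dots> = T (x(n := pprt (x n))) - T (x(n := - nprt (x n)))"
      by (rule linear_diff[OF multilinear_linear[OF T n]])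
    finally have "\<bar>T x\<bar> \<le> \<bar>T (x(n := pprt (x n)))\<bar> + \<bar>T (x(n := - nprt (x n)))\<bar>"
      by linarith
    also have "\<dots> \<le> T (?g(n := pprt (x n))) + T (?g(n := - nprt (x n)))"
      by (intro add_mono IH) auto
    also have "\<dots> = T (?g(n := pprt (x n) + (- nprt (x n))))"
      by (rule linear_add[OF multilinear_linear[OF T n], symmetric])
    also have "\<dots> = T (\<lambda>i. if i < Suc n then \<bar>x i\<bar> else x i)"
      by (rule arg_cong[of _ _ T]) (auto simp: abs_prts)
    finally show ?case .
  qed
  from this[of m x] have "\<bar>T x\<bar> \<le> T (\<lambda>i. if i < m then \<bar>x i\<bar> else x i)" by simp
  also have "\<dots> = T (\<lambda>i. \<bar>x i\<bar>)"
    by (rule multilinear_cong[OF T]) simp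
  finally show ?thesis .
qed

text \<open>In the telescoped difference every argument is some \<open>y i\<close>,
  \<open>y i - x i\<close> or \<open>x i\<close>, hence nonnegative.\<close>

lemma positive_multilinear_mono:
  fixes T :: "(nat \<Rightarrow> 'a::banach_lattice) \<Rightarrow> real"
  assumes T: "multilinear m T" and pos: "\<And>x. (\<And>i. i < m \<Longrightarrow> 0 \<le> x i) \<Longrightarrow> 0 \<le> T x"
    and le: "\<And>i. i < m \<Longrightarrow> 0 \<le> x i \<and> x i \<le> y i"
  shows "T x \<le> T y"
proof -
  have "0 \<le> T y - T x"
    unfolding multilinear_telescope[OF T]
    using le by (intro sum_nonneg pos) (auto intro: order_trans)
  then show ?thesis by simp
qed

section \<open>Orthogonally additive polynomials\<close>

locale dominated_form =
  fixes m :: nat and A T :: "(nat \<Rightarrow> 'a::banach_lattice) \<Rightarrow> real"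
  assumes multilinear: "multilinear m A"
    and multilinear_dom: "multilinear m T"
    and dom_nonneg: "\<And>x. (\<And>i. i < m \<Longrightarrow> 0 \<le> x i) \<Longrightarrow> 0 \<le> T x"
    and abs_le_dom: "\<And>x. \<bar>A x\<bar> \<le> T (\<lambda>i. \<bar>x i\<bar>)"
begin

text \<open>Each of the \<open>m\<close> telescoping terms has one argument bounded by
  \<open>e B\<close> and the others by \<open>B\<close>; the factor \<open>e\<close> comes out of
  \<open>T\<close> by linearity.\<close>

lemma abs_diff_le_dom:
  assumes e: "e \<ge> 0"
    and bounds: "\<And>i. i < m \<Longrightarrow> \<bar>x i\<bar> \<le> B" "\<And>i. i < m \<Longrightarrow> \<bar>x' i\<bar> \<le> B"
    and close: "\<And>i. i < m \<Longrightarrow> \<bar>x' i - x i\<bar> \<le> e *\<^sub>R B"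
  shows "\<bar>A x' - A x\<bar> \<le> real m * (e * T (\<lambda>_. B))"
proof -
  have "\<bar>A (\<lambda>i. if i < j then x' i else if i = j then x' i - x i else x i)\<bar> \<le> e * T (\<lambda>_. B)"
    (is "\<bar>A ?h\<bar> \<le> _") if j: "j < m" for j
  proof -
    have "\<bar>A ?h\<bar> \<le> T (\<lambda>i. \<bar>?h i\<bar>)" by (rule abs_le_dom)
    also have "\<dots> \<le> T ((\<lambda>_. B)(j := e *\<^sub>R B))"
      using bounds close
      by (intro positive_multilinear_mono[OF multilinear_dom dom_nonneg]) auto
    also have "\<dots> = e * T ((\<lambda>_. B)(j := B))"
      using linear_scale[OF multilinear_linear[OF multilinear_dom j]] by simp
    also have "(\<lambda>_. B)(j := B) = (\<lambda>_. B)" by auto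
    finally show ?thesis .
  qed
  then have "\<bar>A x' - A x\<bar> \<le> (\<Sum>j<m. e * T (\<lambda>_. B))"
    unfolding multilinear_telescope[OF multilinear]
    by (intro order_trans[OF sum_abs] sum_mono) simp
  then show ?thesis by simp
qed

end

locale orthogonally_additive_form = dominated_form m A T
  for m and A T :: "(nat \<Rightarrow> 'a::banach_lattice) \<Rightarrow> real" +
  fixes P :: "'a \<Rightarrow> real"
  assumes generates: "generates_poly m A P"
    and add_disjoint: "\<And>x y. disjoint_elems x y \<Longrightarrow> P (x + y) = P x + P y"
begin

lemma poly_eq: "P x = A (\<lambda>_. x)"
  using generates by (simp add: generates_poly_def)

text \<open>Polarization at base point 0 sums over pairs of subsets of \<open>U\<close> and of
  \<open>V\<close>. Orthogonal additivity separates the two variables, and each resulting product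
  contains the alternating sum over all subsets of a nonempty set, which is 0.\<close>

lemma partition_vanishes:
  assumes UV: "U \<union> V = {..<m}" "U \<inter> V = {}" "U \<noteq> {}" "V \<noteq> {}"
    and disj: "\<And>i j. i \<in> U \<Longrightarrow> j \<in> V \<Longrightarrow> disjoint_elems (x i) (x j)"
  shows "A x = 0"
proof -
  have fin: "finite U" "finite V" using UV(1) by (metis finite_Un finite_lessThan)+
  let ?s = "\<lambda>S. \<Sum>i\<in>S. x i"
  have "(\<Sum>S\<in>Pow {..<m}. (-1) ^ card S * P (?s S)) =
      (\<Sum>(S, R)\<in>Pow U \<times> Pow V. (-1) ^ card (S \<union> R) * P (?s (S \<union> R)))"
  proof (rule sum.reindex_bij_witness[of _ "\<lambda>(S, R). S \<union> R" "\<lambda>S. (S \<inter> U, S \<inter> V)"])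
    fix S assume "S \<in> Pow {..<m}"
    then have S: "S \<inter> U \<union> S \<inter> V = S"
      using UV(1) by blast
    then show "(case (S \<inter> U, S \<inter> V) of (S, R) \<Rightarrow> S \<union> R) = S"
      and "(case (S \<inter> U, S \<inter> V) of (S, R) \<Rightarrow> (-1) ^ card (S \<union> R) * P (?s (S \<union> R))) =
        (-1) ^ card S * P (?s S)"
      by simp_all
  next
    fix SR assume "SR \<in> Pow U \<times> Pow V"
    then obtain S R where "SR = (S, R)" "S \<subseteq> U" "R \<subseteq> V" by auto
    then show "((case SR of (S, R) \<Rightarrow> S \<union> R) \<inter> U, (case SR of (S, R) \<Rightarrow> S \<union> R) \<inter> V) = SR"
      and "(case SR of (S, R) \<Rightarrow> S \<union> R) \<in> Pow {..<m}"
      using UV(1,2) by auto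
  qed auto
  also have "\<dots> = (\<Sum>(S, R)\<in>Pow U \<times> Pow V.
      (-1) ^ card S * P (?s S) * (-1) ^ card R + (-1) ^ card S * ((-1) ^ card R * P (?s R)))"
  proof (rule sum.cong[OF refl], clarify)
    fix S R assume SR: "S \<subseteq> U" "R \<subseteq> V"
    then have SR': "finite S" "finite R" "S \<inter> R = {}"
      using fin UV(2) by (auto intro: finite_subset)
    have "disjoint_elems (?s S) (x j)" if "j \<in> R" for j
      using that SR SR' by (intro disjoint_elems_sum disj) auto
    then have "disjoint_elems (?s R) (?s S)"
      using SR' by (intro disjoint_elems_sum) (auto simp: disjoint_elems_commute)
    then have "P (?s (S \<union> R)) = P (?s S) + P (?s R)"
      using SR' add_disjoint by (simp add: sum.union_disjoint disjoint_elems_commute)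
    then show "(-1) ^ card (S \<union> R) * P (?s (S \<union> R)) =
        (-1) ^ card S * P (?s S) * (-1) ^ card R + (-1) ^ card S * ((-1) ^ card R * P (?s R))"
      using SR' by (simp add: card_Un_disjoint power_add algebra_simps)
  qed
  also have "\<dots> = (\<Sum>S\<in>Pow U. (-1) ^ card S * P (?s S)) * (\<Sum>R\<in>Pow V. (-1) ^ card R) +
      (\<Sum>S\<in>Pow U. (-1) ^ card S) * (\<Sum>R\<in>Pow V. (-1) ^ card R * P (?s R))"
    by (simp add: sum_product sum.cartesian_product sum.distrib case_prod_unfold)
  also have "\<dots> = 0"
    using fin UV by (simp add: sum_Pow_alternating)
  finally have "(-1) ^ m * fact m * A x = 0"
    using polarization[OF generates, of 0 x] by simp
  then show ?thesis by simp
qed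

text \<open>
  An argument \<open>w\<close> outside both groups is truncated at a large multiple of the arguments in \<open>V\<close>. The
  truncated part is disjoint from \<open>U\<close>, so it may join \<open>V\<close>. The remainder is disjoint from what is
  left of the arguments in \<open>V\<close> once they are clipped at \<open>\<epsilon>\<bar>w\<bar>\<close>, so it may join \<open>U\<close>.
\<close>

lemma disjoint_groups_vanish:
  assumes "U \<subseteq> {..<m}" "V \<subseteq> {..<m}" "U \<inter> V = {}" "U \<noteq> {}" "V \<noteq> {}"
    and "\<And>i j. i \<in> U \<Longrightarrow> j \<in> V \<Longrightarrow> disjoint_elems (x i) (x j)"
  shows "A x = 0"
  using assms
proof (induction "card ({..<m} - (U \<union> V))" arbitrary: U V x rule: less_induct)
  case less
  note sub = less.prems(1,2) and UV = less.prems(3-5) and disj = less.prems(6)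
  show ?case
  proof (cases "U \<union> V = {..<m}")
    case True
    then show ?thesis using UV disj by (rule partition_vanishes)
  next
    case False
    then obtain k where k: "k < m" "k \<notin> U" "k \<notin> V" using sub by auto
    have "{..<m} - (insert k U \<union> V) \<subset> {..<m} - (U \<union> V)"
      "{..<m} - (U \<union> insert k V) \<subset> {..<m} - (U \<union> V)"
      using k by auto
    \<comment> \<open>The measure is the number of indices outside both groups; it drops whichever
      group \<open>k\<close> joins.\<close>
    then have smaller: "card ({..<m} - (insert k U \<union> V)) < card ({..<m} - (U \<union> V))"
      "card ({..<m} - (U \<union> insert k V)) < card ({..<m} - (U \<union> V))"
      by (auto intro: psubset_card_mono)
    have finV: "finite V" using sub finite_subset by blast
    define w Y B where "w = x k" and "Y = (\<Sum>j\<in>V. \<bar>x j\<bar>)" and "B = (\<Sum>i<m. \<bar>x i\<bar>)"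
    have Y: "\<bar>x j\<bar> \<le> Y" if "j \<in> V" for j
      unfolding Y_def using finV that by (rule abs_le_sum_abs)
    have Y0: "0 \<le> Y" unfolding Y_def by (intro sum_nonneg) auto
    have B: "\<bar>x i\<bar> \<le> B" if "i < m" for i
      unfolding B_def using that by (intro abs_le_sum_abs) auto
    have bound: "\<bar>A x\<bar> \<le> real m * (e * T (\<lambda>_. B))" if e: "e > 0" for e
    proof -
      have eY: "0 \<le> (1/e) *\<^sub>R Y" using e Y0 by (intro scaleR_nonneg_nonneg) auto
      obtain w1 w2 where w: "w = w1 + w2" "\<bar>w1\<bar> \<le> (1/e) *\<^sub>R Y" "\<bar>w2\<bar> \<le> pprt (\<bar>w\<bar> - (1/e) *\<^sub>R Y)"
        using clip[OF eY, of w] by blast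
      have w2: "\<bar>w2\<bar> \<le> \<bar>w\<bar>"
        using w(3) pprt_abs_diff_le[OF eY] by (rule order_trans)
      have ew: "0 \<le> e *\<^sub>R \<bar>w\<bar>" using e by (intro scaleR_nonneg_nonneg) auto
      have "\<exists>q. \<bar>x j - q\<bar> \<le> e *\<^sub>R \<bar>w\<bar> \<and> \<bar>q\<bar> \<le> pprt (\<bar>x j\<bar> - e *\<^sub>R \<bar>w\<bar>)" for j
        using clip[OF ew, of "x j"] by (metis add_diff_cancel_right')
      then obtain q where q: "\<And>j. \<bar>x j - q j\<bar> \<le> e *\<^sub>R \<bar>w\<bar>"
        "\<And>j. \<bar>q j\<bar> \<le> pprt (\<bar>x j\<bar> - e *\<^sub>R \<bar>w\<bar>)" by metis
      have qx: "\<bar>q j\<bar> \<le> \<bar>x j\<bar>" for j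
        using q(2) pprt_abs_diff_le[OF ew] by (rule order_trans)
      have disj_q: "disjoint_elems w2 (q j)" if j: "j \<in> V" for j
      proof -
        have "(1/e) *\<^sub>R \<bar>x j\<bar> \<le> (1/e) *\<^sub>R Y"
          using e Y[OF j] by (intro scaleR_left_mono) auto
        then have "\<bar>w2\<bar> \<le> pprt (\<bar>w\<bar> - (1/e) *\<^sub>R \<bar>x j\<bar>)"
          using w(3) by (elim order_trans) (auto intro!: pprt_mono)
        then show ?thesis
          using disjoint_elems_clipped[OF e q(2)[of j]] disjoint_elems_commute by blast
      qed
      have Ydisj: "disjoint_elems (x i) w1" if i: "i \<in> U" for i
      proof -
        have "disjoint_elems \<bar>x j\<bar> (x i)" if "j \<in> V" for j
          using disj[OF i that] by (simp add: disjoint_elems_def inf_commute)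
        then have "disjoint_elems Y (x i)"
          unfolding Y_def using finV by (rule disjoint_elems_sum[rotated])
        then have "disjoint_elems ((1/e) *\<^sub>R Y) (x i)" by (rule disjoint_elems_scaleR)
        then have "disjoint_elems w1 (x i)"
          by (rule disjoint_elems_mono) (use w(2) eY in auto)
        then show ?thesis by (simp add: disjoint_elems_commute)
      qed
      have A1: "A (x(k := w1)) = 0"
        by (rule less.hyps[OF smaller(2)]) (use k sub UV disj Ydisj in auto)
      \<comment> \<open>\<open>?x''\<close> clips the arguments in \<open>V\<close> on top of
        replacing argument \<open>k\<close> by \<open>w2\<close>. It differs from \<open>?x'\<close>
        only on \<open>V\<close>, by at most \<open>e|w|\<close> in each slot.\<close>
      let ?x' = "x(k := w2)" and ?x'' = "\<lambda>i. if i = k then w2 else if i \<in> V then q i else x i"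
      have A2: "A ?x'' = 0"
      proof (rule less.hyps[OF smaller(1)])
        fix i j assume ij: "i \<in> insert k U" "j \<in> V"
        show "disjoint_elems (?x'' i) (?x'' j)"
        proof (cases "i = k")
          case True
          then show ?thesis using ij disj_q k by auto
        next
          case False
          then have "i \<in> U" "i \<notin> V" "j \<noteq> k" using ij UV k by auto
          moreover have "disjoint_elems (x i) (q j)"
            using disj[OF \<open>i \<in> U\<close> ij(2)] qx by (rule disjoint_elems_mono[OF _ order_refl])
          ultimately show ?thesis using ij False by simp
        qed
      qed (use k sub UV in auto)
      have "A x = A (x(k := w1)) + A (x(k := w2))"
        using linear_add[OF multilinear_linear[OF multilinear k(1), of x], of w1 w2] w(1)
        by (simp add: w_def flip: w(1))
      then have "\<bar>A x\<bar> = \<bar>A ?x' - A ?x''\<bar>" using A1 A2 by simp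
      also have "\<dots> \<le> real m * (e * T (\<lambda>_. B))"
      proof (rule abs_diff_le_dom)
        show "e \<ge> 0" using e by simp
        have wB: "\<bar>w\<bar> \<le> B" using B[OF k(1)] by (simp add: w_def)
        then have ewB: "e *\<^sub>R \<bar>w\<bar> \<le> e *\<^sub>R B" "0 \<le> e *\<^sub>R B"
          using e ew by (auto intro!: scaleR_left_mono intro: order_trans)
        fix i assume i: "i < m"
        show "\<bar>?x'' i\<bar> \<le> B" "\<bar>?x' i\<bar> \<le> B"
          using B[OF i] w2 wB qx[of i] by (auto intro: order_trans)
        show "\<bar>?x' i - ?x'' i\<bar> \<le> e *\<^sub>R B"
          using ewB q(1)[of i] by (auto intro: order_trans)
      qed
      finally show ?thesis .
    qed
    \<comment> \<open>The left side of \<open>bound\<close> does not depend on \<open>e\<close>, so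
      letting \<open>e\<close> tend to 0 from the right gives \<open>A x = 0\<close>.\<close>
    have "((\<lambda>e. real m * (e * T (\<lambda>_. B))) \<longlongrightarrow> real m * (0 * T (\<lambda>_. B))) (at_right 0)"
      by (intro tendsto_intros)
    moreover have "eventually (\<lambda>e. \<bar>A x\<bar> \<le> real m * (e * T (\<lambda>_. B))) (at_right 0)"
      using bound by (auto simp: eventually_at_right_less intro: eventually_mono[OF eventually_at_right_less])
    ultimately have "\<bar>A x\<bar> \<le> real m * (0 * T (\<lambda>_. B))"
      by (intro tendsto_lowerbound) auto
    then show ?thesis by simp
  qed
qed

lemma orthosymmetric:
  assumes "j < m" "k < m" "j \<noteq> k" "disjoint_elems (x j) (x k)"
  shows "A x = 0"
  by (rule disjoint_groups_vanish[of "{j}" "{k}"]) (use assms in auto)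

text \<open>In the telescoped difference the term \<open>j = k\<close> has a zero argument. Every
  other term has the disjoint arguments \<open>x' j - x j\<close> and \<open>x k\<close> in slots
  \<open>j\<close> and \<open>k\<close>.\<close>

lemma perturb_disjoint:
  assumes k: "k < m" and eq: "x' k = x k"
    and disj: "\<And>i. i < m \<Longrightarrow> i \<noteq> k \<Longrightarrow> disjoint_elems (x' i - x i) (x k)"
  shows "A x' = A x"
proof -
  have "A (\<lambda>i. if i < j then x' i else if i = j then x' i - x i else x i) = 0" if j: "j < m" for j
  proof (cases "j = k")
    case True
    then show ?thesis
      using eq by (intro multilinear_zero[OF multilinear j]) auto
  next
    case False
    then show ?thesis
      using disj[OF j] eq k j by (intro orthosymmetric[of j k]) auto
  qed
  then show ?thesis
    using multilinear_telescope[OF multilinear, of x' x] by simp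
qed

text \<open>Both differences telescope with \<open>w\<close> in slot \<open>j\<close> of the
  \<open>j\<close>-th term. The remaining slots differ by \<open>u\<close>, which is disjoint from
  \<open>w\<close>, so the terms agree one by one.\<close>

lemma poly_valuation:
  assumes "disjoint_elems u w"
  shows "P (u + v + w) - P (u + v) = P (v + w) - P v"
proof -
  have "A (\<lambda>i. if i < j then u + v + w else if i = j then (u + v + w) - (u + v) else u + v) =
      A (\<lambda>i. if i < j then v + w else if i = j then (v + w) - v else v)" if "j < m" for j
    using assms that by (intro perturb_disjoint[of j]) (auto simp: algebra_simps)
  then show ?thesis
    by (simp add: poly_eq multilinear_telescope[OF multilinear])
qed

end

section \<open>Order continuity\<close>

lemma decreases_to_0_scaleR:
  assumes y: "decreases_to_0 I r y" and c: "c > 0"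
  shows "decreases_to_0 I r (\<lambda>i. c *\<^sub>R y i)"
proof -
  have glb: "isGlb UNIV (y ` I) 0"
    using y by (simp add: decreases_to_0_def)
  have "z \<le> 0" if "\<And>i. i \<in> I \<Longrightarrow> z \<le> c *\<^sub>R y i" for z
  proof -
    have "inverse c *\<^sub>R z \<le> y i" if "i \<in> I" for i
      using \<open>\<And>i. i \<in> I \<Longrightarrow> z \<le> c *\<^sub>R y i\<close>[OF that] c by (simp add: pos_divideR_le_eq)
    then have "isLb UNIV (y ` I) (inverse c *\<^sub>R z)"
      by (auto simp: isLb_def setge_def)
    then have "inverse c *\<^sub>R z \<le> 0"
      using glb isGlb_le_isLb by blast
    then show ?thesis using c by (simp add: pos_divideR_le_eq)
  qed
  moreover have "0 \<le> c *\<^sub>R y i" if "i \<in> I" for i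
    using isGlbD2[OF glb] that c by (auto intro!: scaleR_nonneg_nonneg)
  ultimately have "isGlb UNIV ((\<lambda>i. c *\<^sub>R y i) ` I) 0"
    by (auto simp: isGlb_def greatestP_def isLb_def setge_def setle_def)
  then show ?thesis
    using y c by (auto simp: decreases_to_0_def intro!: scaleR_left_mono)
qed

lemma order_continuous_at_dominated:
  fixes P :: "'a::banach_lattice \<Rightarrow> real" and I :: "('a \<times> 'a) set"
  assumes "order_continuous_at P a" "directed_set I r" "decreases_to_0 I r y" "c > 0" "i\<^sub>0 \<in> I"
    and "\<And>i. i \<in> I \<Longrightarrow> (i\<^sub>0, i) \<in> r \<Longrightarrow> \<bar>x i - a\<bar> \<le> c *\<^sub>R y i"
  shows "((\<lambda>i. P (x i)) \<longlongrightarrow> P a) (net_filter I r)"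
proof -
  have "order_converges I r x a"
    unfolding order_converges_def
    using decreases_to_0_scaleR[OF assms(3,4)] assms(5,6) by blast
  then show ?thesis
    using assms(1,2) by (auto simp: order_continuous_at_def)
qed

context orthogonally_additive_form
begin

text \<open>Polarization with all increments equal to \<open>u i\<close> writes
  \<open>P (u i)\<close>, up to a nonzero constant, as an alternating sum of values
  \<open>P (a + n u i)\<close>. Each of these tends to \<open>P a\<close>, and the signs add up to 0
  because \<open>m\<close> is positive.\<close>

lemma tendsto_poly_dominated:
  fixes I :: "('a \<times> 'a) set"
  assumes m: "m \<ge> 1" and cont: "order_continuous_at P a"
    and net: "directed_set I r" "decreases_to_0 I r y" "c > 0" "i\<^sub>0 \<in> I"
    and le: "\<And>i. i \<in> I \<Longrightarrow> (i\<^sub>0, i) \<in> r \<Longrightarrow> \<bar>u i\<bar> \<le> c *\<^sub>R y i"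
  shows "((\<lambda>i. P (u i)) \<longlongrightarrow> 0) (net_filter I r)"
proof -
  have "((\<lambda>i. P (a + real n *\<^sub>R u i)) \<longlongrightarrow> P a) (net_filter I r)" for n
  proof (rule order_continuous_at_dominated[OF cont net(1,2) _ net(4)])
    \<comment> \<open>The factor \<open>n + 1\<close> instead of \<open>n\<close> keeps the constant
      positive for \<open>n = 0\<close>.\<close>
    show "(real n + 1) * c > 0" using net(3) by simp
    fix i assume i: "i \<in> I" "(i\<^sub>0, i) \<in> r"
    have "\<bar>real n *\<^sub>R u i\<bar> \<le> real n *\<^sub>R \<bar>u i\<bar>"
      using abs_scaleR_le[of "real n" "u i"] by simp
    also have "\<dots> \<le> (real n + 1) *\<^sub>R \<bar>u i\<bar>"
      by (intro scaleR_right_mono) auto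
    also have "\<dots> \<le> (real n + 1) *\<^sub>R (c *\<^sub>R y i)"
      by (intro scaleR_left_mono le i) auto
    finally show "\<bar>a + real n *\<^sub>R u i - a\<bar> \<le> ((real n + 1) * c) *\<^sub>R y i" by simp
  qed
  then have "((\<lambda>i. \<Sum>S\<in>Pow {..<m}. (-1) ^ card S * P (a + real (card S) *\<^sub>R u i)) \<longlongrightarrow>
      (\<Sum>S\<in>Pow {..<m}. (-1) ^ card S * P a)) (net_filter I r)"
    by (intro tendsto_sum tendsto_mult tendsto_const)
  moreover have "(\<Sum>S\<in>Pow {..<m}. (-1) ^ card S * P a) = 0"
    using sum_Pow_alternating[of "{..<m}"] m
    by (simp add: lessThan_empty_iff flip: sum_distrib_right)
  moreover have "(\<Sum>S\<in>Pow {..<m}. (-1) ^ card S * P (a + real (card S) *\<^sub>R u i)) =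
      (-1) ^ m * fact m * P (u i)" for i
    using polarization[OF generates, of a "\<lambda>_. u i"]
    by (simp add: poly_eq sum_constant_scaleR)
  ultimately have "((\<lambda>i. (-1) ^ m * fact m * P (u i)) \<longlongrightarrow> 0) (net_filter I r)"
    by simp
  then have "((\<lambda>i. (-1) ^ m / fact m * ((-1) ^ m * fact m * P (u i))) \<longlongrightarrow> (-1) ^ m / fact m * 0)
      (net_filter I r)"
    by (intro tendsto_mult tendsto_const)
  moreover have "(-1) ^ m / fact m * ((-1) ^ m * fact m * P (u i)) = P (u i)" for i
  proof -
    have "(-1) ^ m * (-1) ^ m = (1::real)" by (simp flip: power_mult_distrib)
    then show ?thesis by (simp add: field_simps)
  qed
  ultimately show ?thesis by simp
qed

lemma order_continuous_at_transfer:
  assumes m: "m \<ge> 1" and cont: "order_continuous_at P a"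
  shows "order_continuous_at P b"
  unfolding order_continuous_at_def
proof (intro allI impI)
  fix I :: "('a \<times> 'a) set" and r x
  assume dir: "directed_set I r" and conv: "order_converges I r x b"
  obtain y i\<^sub>0 where y: "decreases_to_0 I r y" and i0: "i\<^sub>0 \<in> I"
    and le: "\<And>i. i \<in> I \<Longrightarrow> (i\<^sub>0, i) \<in> r \<Longrightarrow> \<bar>x i - b\<bar> \<le> y i"
    using conv unfolding order_converges_def by blast
  \<comment> \<open>\<open>B\<close> bounds both \<open>|x i|\<close> and \<open>|b + s i|\<close>
    once \<open>i\<close> is beyond the index \<open>i\<^sub>0\<close>, since \<open>y\<close>
    decreases.\<close>
  define B where "B = \<bar>b\<bar> + y i\<^sub>0"
  define C where "C = real m * T (\<lambda>_. B)"
  have y0: "0 \<le> y i\<^sub>0"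
    using y i0 by (auto simp: decreases_to_0_def dest!: isGlbD2)
  then have bB: "\<bar>b\<bar> \<le> B" and B0: "0 \<le> B" by (auto simp: B_def)
  then have C: "C \<ge> 0" unfolding C_def by (intro mult_nonneg_nonneg dom_nonneg) auto
  show "((\<lambda>i. P (x i)) \<longlongrightarrow> P b) (net_filter I r)"
  proof (rule tendstoI)
    fix \<delta> :: real assume \<delta>: "\<delta> > 0"
    \<comment> \<open>Chosen to make \<open>e C\<close> less than half of \<open>\<delta>\<close>;
      the added 1 covers \<open>C = 0\<close>. The other half is shared by
      \<open>P (t i + s i)\<close> and \<open>P (t i)\<close>.\<close>
    define e where "e = \<delta> / (2 * (C + 1))"
    have e: "e > 0" using \<delta> C by (simp add: e_def)
    have "e * C < e * (C + 1)" using e by simp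
    also have "\<dots> = \<delta> / 2" using C by (simp add: e_def field_simps)
    finally have eC: "e * C < \<delta> / 2" .
    have "\<exists>s t. \<bar>x i - b - s\<bar> \<le> e *\<^sub>R \<bar>b\<bar> \<and> \<bar>s\<bar> \<le> \<bar>x i - b\<bar> \<and>
        \<bar>t\<bar> \<le> (1/e) *\<^sub>R \<bar>x i - b\<bar> \<and> disjoint_elems (b - t) s" for i
      using disjoint_splitting[OF e, of "x i - b" b] by metis
    then obtain s t where s: "\<And>i. \<bar>x i - b - s i\<bar> \<le> e *\<^sub>R \<bar>b\<bar>" "\<And>i. \<bar>s i\<bar> \<le> \<bar>x i - b\<bar>"
      and t: "\<And>i. \<bar>t i\<bar> \<le> (1/e) *\<^sub>R \<bar>x i - b\<bar>" and st: "\<And>i. disjoint_elems (b - t i) (s i)"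
      by metis
    have t_le: "\<bar>t i\<bar> \<le> (1/e) *\<^sub>R y i" if "i \<in> I" "(i\<^sub>0, i) \<in> r" for i
      using order_trans[OF t scaleR_left_mono[OF le[OF that]]] e by simp
    have "\<bar>t i + s i\<bar> \<le> (1/e + 1) *\<^sub>R y i" if "i \<in> I" "(i\<^sub>0, i) \<in> r" for i
    proof -
      have "\<bar>t i + s i\<bar> \<le> \<bar>t i\<bar> + \<bar>s i\<bar>" by (rule abs_triangle_ineq)
      also have "\<dots> \<le> (1/e) *\<^sub>R y i + y i"
        using t_le[OF that] order_trans[OF s(2) le[OF that]] by (rule add_mono)
      finally show ?thesis by (simp add: scaleR_left_distrib)
    qed
    then have "((\<lambda>i. P (t i + s i)) \<longlongrightarrow> 0) (net_filter I r)"
      using e by (intro tendsto_poly_dominated[OF m cont dir y _ i0, of "1/e + 1"]) (auto intro: add_pos_pos)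
    then have ev1: "eventually (\<lambda>i. \<bar>P (t i + s i)\<bar> < \<delta> / 4) (net_filter I r)"
      using \<delta> by (auto simp: tendsto_iff dest!: spec[of _ "\<delta> / 4"])
    have "((\<lambda>i. P (t i)) \<longlongrightarrow> 0) (net_filter I r)"
      using e t_le by (intro tendsto_poly_dominated[OF m cont dir y _ i0, of "1/e"]) auto
    then have ev2: "eventually (\<lambda>i. \<bar>P (t i)\<bar> < \<delta> / 4) (net_filter I r)"
      using \<delta> by (auto simp: tendsto_iff dest!: spec[of _ "\<delta> / 4"])
    have "eventually (\<lambda>i. i \<in> I \<and> (i\<^sub>0, i) \<in> r) (net_filter I r)"
      unfolding eventually_net_filter[OF dir] using i0 by blast
    with ev1 ev2 show "eventually (\<lambda>i. dist (P (x i)) (P b) < \<delta>) (net_filter I r)"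
    proof eventually_elim
      case (elim i)
      then have i: "i \<in> I" "(i\<^sub>0, i) \<in> r" by auto
      have "y i \<le> y i\<^sub>0"
        using y i i0 by (auto simp: decreases_to_0_def)
      then have z: "\<bar>x i - b\<bar> \<le> y i\<^sub>0" using le[OF i] by (rule order_trans[rotated])
      have "\<bar>P (x i) - P (b + s i)\<bar> \<le> real m * (e * T (\<lambda>_. B))"
        unfolding poly_eq
      proof (rule abs_diff_le_dom)
        show "0 \<le> e" using e by simp
        have "\<bar>b + s i\<bar> \<le> \<bar>b\<bar> + \<bar>s i\<bar>" by (rule abs_triangle_ineq)
        also have "\<dots> \<le> B" unfolding B_def using order_trans[OF s(2) z] by simp
        finally show "\<bar>b + s i\<bar> \<le> B" .
        have "\<bar>b + (x i - b)\<bar> \<le> \<bar>b\<bar> + \<bar>x i - b\<bar>" by (rule abs_triangle_ineq)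
        also have "\<dots> \<le> B" unfolding B_def using z by simp
        finally show "\<bar>x i\<bar> \<le> B" by simp
        have "\<bar>x i - b - s i\<bar> \<le> e *\<^sub>R B"
          using order_trans[OF s(1) scaleR_left_mono[OF bB]] e by simp
        then show "\<bar>x i - (b + s i)\<bar> \<le> e *\<^sub>R B" by (simp add: algebra_simps)
      qed
      then have "\<bar>P (x i) - P (b + s i)\<bar> < \<delta> / 2"
        using eC by (simp add: C_def mult_ac)
      \<comment> \<open>The valuation identity with \<open>u = b - t i\<close>,
        \<open>v = t i\<close> and \<open>w = s i\<close>.\<close>
      moreover have "P (b + s i) - P b = P (t i + s i) - P (t i)"
        using poly_valuation[OF st, of i "t i"] by simp
      ultimately show ?case
        using elim unfolding dist_real_def by linarith
    qed
  qed
qed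

end

theorem proposition8:
  fixes P :: "'a::banach_lattice \<Rightarrow> real" and m :: nat
  assumes "m \<ge> 1"
    and "orthogonally_additive_poly m P"
    and "\<exists>a. order_continuous_at P a"
  shows "\<forall>x. order_continuous_at P x"
proof -
  obtain a where a: "order_continuous_at P a" using assms(3) by blast
  have "regular_poly m P"
    and add: "\<And>x y. disjoint_elems x y \<Longrightarrow> P (x + y) = P x + P y"
    using assms(2) by (auto simp: orthogonally_additive_poly_def)
  then obtain Q R where "positive_poly m Q" "positive_poly m R" and PQR: "\<And>x. P x = Q x - R x"
    by (auto simp: regular_poly_def)
  then obtain F G where F: "generates_poly m F Q" "\<And>x. (\<forall>i<m. 0 \<le> x i) \<Longrightarrow> 0 \<le> F x"
    and G: "generates_poly m G R" "\<And>x. (\<forall>i<m. 0 \<le> x i) \<Longrightarrow> 0 \<le> G x"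
    by (auto simp: positive_poly_def)
  have FG: "multilinear m F" "multilinear m G"
    using F G by (auto simp: generates_poly_def)
  have diff: "multilinear m (\<lambda>x. F x - G x)"
    using FG unfolding multilinear_def by (auto intro: linear_compose_sub) metis
  have sum: "multilinear m (\<lambda>x. F x + G x)"
    using FG unfolding multilinear_def by (auto intro: linear_compose_add) metis
  \<comment> \<open>Regularity supplies the dominating form: with \<open>P = Q - R\<close> and
    positive forms \<open>F\<close> and \<open>G\<close> generating \<open>Q\<close> and
    \<open>R\<close>, the form \<open>F - G\<close> generates \<open>P\<close> and is dominated by
    \<open>F + G\<close>.\<close>
  interpret orthogonally_additive_form m "\<lambda>x. F x - G x" "\<lambda>x. F x + G x" P
  proof
    show "generates_poly m (\<lambda>x. F x - G x) P"
      using diff F(1) G(1) PQR by (auto simp: generates_poly_def symmetric_map_def)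
    fix x :: "nat \<Rightarrow> 'a"
    have "\<bar>F x\<bar> \<le> F (\<lambda>i. \<bar>x i\<bar>)" "\<bar>G x\<bar> \<le> G (\<lambda>i. \<bar>x i\<bar>)"
      using FG F(2) G(2) by (auto intro: positive_multilinear_abs_le)
    then show "\<bar>F x - G x\<bar> \<le> F (\<lambda>i. \<bar>x i\<bar>) + G (\<lambda>i. \<bar>x i\<bar>)" by linarith
  qed (use diff sum F(2) G(2) add in \<open>auto intro!: add_nonneg_nonneg\<close>)
  show ?thesis
    using order_continuous_at_transfer[OF assms(1) a] by blast
qed

end
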